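(* For $n\ge 1$ and $0\le p\le n-1$, let $C_{n,p}$ be the number of configurations of size $n$ in which exactly $p$ of the other $n-1$ pairs are contained by the given pair. Then $$C(y,z):=\sum_{n\geq 1}\sum_{p=0}^{n-1} C_{n,p}\, y^p \,\frac{z^n}{n!}=\frac{\sqrt{1-2yz}-\sqrt{1-2z}}{(1-2z)(1-y)}.$$
   Context: Fix $n\ge1$. A configuration (of size $n$) is a perfect matching of the $2n$ points $1,2,\dots,2n$ (laid out on a line) into $n$ unordered pairs, together with one distinguished pair, called the given pair; the other $n-1$ pairs are treated as indistinguishable, so there are $n\,(2n-1)!!$ configurations. Let the given pair be $\{g<h\}$ and let $\{a<b\}$ be another pair. The pair $\{a,b\}$ is contained by the given pair if $g<a<b<h$. *)

theory Defs
  imports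
    "HOL-Library.Disjoint_Sets"
    "HOL-Computational_Algebra.Computational_Algebra"
begin

definition perfect_matchings :: "nat \<Rightarrow> nat set set set" where
  "perfect_matchings n = {M. partition_on {1..2 * n} M \<and> (\<forall>e\<in>M. card e = 2)}"

(* The second component is the given pair. Since a matching is a set of pairs, the other
   pairs carry no labels. *)
definition configurations :: "nat \<Rightarrow> (nat set set \<times> nat set) set" where
  "configurations n = {(M, e). M \<in> perfect_matchings n \<and> e \<in> M}"

definition contained_by :: "nat set \<Rightarrow> nat set \<Rightarrow> bool" where
  "contained_by e' e \<longleftrightarrow>
     (\<exists>g h a b. e = {g, h} \<and> e' = {a, b} \<and> g < a \<and> a < b \<and> b < h)"

definition C_count :: "nat \<Rightarrow> nat \<Rightarrow> nat" where
  "C_count n p =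
     card {(M, e) \<in> configurations n. card {e' \<in> M - {e}. contained_by e' e} = p}"

(* Generating functions are formal power series in z over the field of rational functions in y
   with rational coefficients, in which both 1 - y and 1 - 2z are units. *)
type_synonym ratfun = "rat poly fract"

definition Y :: ratfun where
  "Y = Fract [:0, 1:] 1"

definition C_gf :: "ratfun fps" where
  "C_gf = Abs_fps (\<lambda>n. if n = 0 then 0
                        else (\<Sum>p = 0..n - 1. of_nat (C_count n p) * Y ^ p) / fact n)"

(* For a series with constant term 1, the square root whose constant term is again 1. The first
   argument of fps_radical selects the root of the constant term. *)
definition sqrt_fps :: "'a::field_char_0 fps \<Rightarrow> 'a fps" where
  "sqrt_fps f = fps_radical (\<lambda>_ _. 1) 2 f"

lemma sqrt_fps_unique:
  assumes "fps_nth f 0 = 1"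
  shows "g ^ 2 = f \<and> fps_nth g 0 = 1 \<longleftrightarrow> g = sqrt_fps f"
proof
  assume "g ^ 2 = f \<and> fps_nth g 0 = 1"
  then show "g = sqrt_fps f"
    using radical_unique[of "\<lambda>_ _. 1" 1 f g] assms
    by (simp add: sqrt_fps_def numeral_2_eq_2)
next
  assume "g = sqrt_fps f"
  then show "g ^ 2 = f \<and> fps_nth g 0 = 1"
    using power_radical[of f "\<lambda>_ _. 1" 1] assms
    by (simp add: sqrt_fps_def numeral_2_eq_2)
qed

end

(* Deleting the given pair {g < h} leaves a matching of 2k points, k = n - 1, in which we count the
   pairs lying inside the set S of the s = h - g - 1 points between g and h; there are 2k + 1 - s
   given pairs with this gap. The sum of y^(number of pairs inside S) over all matchings depends
   only on k and s, and satisfies a recurrence obtained by matching a point outside S first.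
   Summing that recurrence over s, with weights s + 1 and 2k + 1 - s, gives for the polynomials
   C_n(y) = sum_p C_{n,p} y^p the recurrence
     C_n(y) = 2n C_{n-1}(y) + (2n-3)!! (1 + y + ... + y^(n-1)),
   so that (1 - 2z)(1 - y) C(y,z) has coefficients (2n-3)!! (1 - y^n) / n!, which are those of
   sqrt(1 - 2yz) - sqrt(1 - 2z) by the binomial series. *)
theory Submission
  imports Defs
begin

section \<open>Perfect matchings of a finite set\<close>

text \<open>The ground set is arbitrary because deleting pairs from \<open>{1..2 * n}\<close> leaves
  sets that are no longer of this form.\<close>

definition matchings :: "'a set \<Rightarrow> 'a set set set" where
  "matchings A = {M. partition_on A M \<and> (\<forall>e\<in>M. card e = 2)}"

lemma finite_matchings:
  assumes "finite A"
  shows "finite (matchings A)"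
  by (rule finite_subset[of _ "Pow (Pow A)"])
    (use assms in \<open>auto simp: matchings_def partition_on_def\<close>)

lemma finite_matching:
  assumes "finite A" "M \<in> matchings A"
  shows "finite M"
  using assms finite_elements[of A M] by (auto simp: matchings_def)

lemma matchings_empty [simp]: "matchings {} = {{}}"
  by (auto simp: matchings_def partition_on_def)

lemma matchingsD:
  assumes "M \<in> matchings A" "e \<in> M"
  shows "e \<subseteq> A" "card e = 2"
  using assms by (auto simp: matchings_def partition_on_def)

lemma insert_matching:
  assumes "e \<subseteq> A" "card e = 2" "M \<in> matchings (A - e)"
  shows "insert e M \<in> matchings A" "e \<notin> M"
proof -
  have ne: "e \<noteq> {}" using assms(2) by auto
  show "e \<notin> M" using assms(3) ne by (auto simp: matchings_def partition_on_def)
  show "insert e M \<in> matchings A"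
    using assms ne by (auto simp: matchings_def partition_on_def disjoint_def)
qed

lemma remove_matching:
  assumes "M \<in> matchings A" "e \<in> M"
  shows "M - {e} \<in> matchings (A - e)"
  using assms by (fastforce simp: matchings_def partition_on_def disjoint_def)

text \<open>Inserting \<open>e\<close> and deleting \<open>e\<close> are mutually inverse bijections
  between the two index sets.\<close>

lemma sum_matchings_containing:
  assumes "e \<subseteq> A" "card e = 2"
  shows "(\<Sum>M | M \<in> matchings A \<and> e \<in> M. f M) = (\<Sum>M\<in>matchings (A - e). f (insert e M))"
proof (rule sum.reindex_bij_witness[of _ "insert e" "\<lambda>M. M - {e}"])
  fix M assume "M \<in> matchings (A - e)"
  then show "insert e M - {e} = M" "insert e M \<in> {M \<in> matchings A. e \<in> M}"
    using insert_matching[OF assms] by auto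
qed (auto intro: remove_matching simp: insert_absorb)

text \<open>Each matching pairs \<open>x\<close> with exactly one \<open>z\<close>: its pairs cover
  \<open>A\<close>, and disjointness forbids a second partner. So the matchings split into classes
  by the partner of \<open>x\<close>, and in each class the pair of \<open>x\<close> can be
  removed.\<close>

lemma sum_matchings_by_partner:
  assumes "finite A" "x \<in> A"
  shows "(\<Sum>M\<in>matchings A. f M) =
    (\<Sum>z\<in>A - {x}. \<Sum>M\<in>matchings (A - {x, z}). f (insert {x, z} M))"
proof -
  have decomp: "matchings A = (\<Union>z\<in>A - {x}. {M \<in> matchings A. {x, z} \<in> M})"
  proof (intro set_eqI iffI)
    fix M assume M: "M \<in> matchings A"
    then have "\<Union>M = A" and two: "\<forall>e\<in>M. card e = 2"
      by (auto simp: matchings_def partition_on_def)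
    then obtain e where e: "e \<in> M" "x \<in> e" using assms(2) by auto
    with two obtain a b where "e = {a, b}" "a \<noteq> b" by (meson card_2_iff)
    with e obtain z where "e = {x, z}" "z \<noteq> x" by (cases "x = a") auto
    with e M \<open>\<Union>M = A\<close> show "M \<in> (\<Union>z\<in>A - {x}. {M \<in> matchings A. {x, z} \<in> M})" by blast
  qed auto
  have "(\<Sum>M\<in>matchings A. f M) = (\<Sum>z\<in>A - {x}. \<Sum>M | M \<in> matchings A \<and> {x, z} \<in> M. f M)"
  proof (subst decomp, rule sum.UNION_disjoint)
    have "z = w" if M: "M \<in> matchings A" and zw: "{x, z} \<in> M" "{x, w} \<in> M" for M z w
    proof -
      have "{x, z} = {x, w}"
        using M zw disjointD[of M "{x, z}" "{x, w}"]
        by (auto simp: matchings_def partition_on_def)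
      then show ?thesis by (auto simp: doubleton_eq_iff)
    qed
    then show "\<forall>z\<in>A - {x}. \<forall>w\<in>A - {x}. z \<noteq> w \<longrightarrow>
      {M \<in> matchings A. {x, z} \<in> M} \<inter> {M \<in> matchings A. {x, w} \<in> M} = {}"
      by blast
  qed (simp_all add: assms finite_matchings)
  also have "\<dots> = (\<Sum>z\<in>A - {x}. \<Sum>M\<in>matchings (A - {x, z}). f (insert {x, z} M))"
    by (intro sum.cong sum_matchings_containing) (use assms in auto)
  finally show ?thesis .
qed

section \<open>Matchings weighted by the pairs inside a subset\<close>

text \<open>In the application \<open>S\<close> consists of the points strictly between the two ends
  of the given pair, and \<open>A\<close> is what remains after deleting these ends.\<close>

definition weight :: "'a :: comm_semiring_1 \<Rightarrow> 'b set \<Rightarrow> 'b set \<Rightarrow> 'a" where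
  "weight y A S = (\<Sum>M\<in>matchings A. y ^ card {e \<in> M. e \<subseteq> S})"

text \<open>The pair \<open>{x, z}\<close> contributes a factor \<open>y\<close> exactly when both
  its points lie in \<open>S\<close>. All other pairs avoid \<open>x\<close> and \<open>z\<close>,
  so removing these points from \<open>S\<close> does not change which of those pairs lie inside
  it.\<close>

lemma weight_by_partner:
  assumes "finite A" "x \<in> A"
  shows "weight y A S =
    (\<Sum>z\<in>A - {x}. (if x \<in> S \<and> z \<in> S then y else 1) * weight y (A - {x, z}) (S - {x, z}))"
proof -
  have "y ^ card {e \<in> insert {x, z} M. e \<subseteq> S} =
      (if x \<in> S \<and> z \<in> S then y else 1) * y ^ card {e \<in> M. e \<subseteq> S - {x, z}}"
    if z: "z \<in> A - {x}" and M: "M \<in> matchings (A - {x, z})" for z M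
  proof -
    have sub: "e \<inter> {x, z} = {}" if "e \<in> M" for e
      using that M by (auto simp: matchings_def partition_on_def)
    have "{x, z} \<notin> M" using sub by blast
    have fin: "finite M" using finite_matching[OF _ M] assms by auto
    have *: "{e \<in> M. e \<subseteq> S - {x, z}} = {e \<in> M. e \<subseteq> S}" using sub by blast
    have "{e \<in> insert {x, z} M. e \<subseteq> S} =
      (if x \<in> S \<and> z \<in> S then insert {x, z} {e \<in> M. e \<subseteq> S} else {e \<in> M. e \<subseteq> S})"
      by auto
    then show ?thesis using \<open>{x, z} \<notin> M\<close> fin by (simp add: *)
  qed
  then show ?thesis
    unfolding weight_def sum_matchings_by_partner[OF assms] sum_distrib_left
    by (intro sum.cong refl) auto
qed

text \<open>When \<open>s = 2 * k + 2\<close>, there is no point outside the set to match first, and the truncated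
  subtraction in the general recurrence would give a wrong value.\<close>
fun weight_poly :: "'a :: comm_semiring_1 \<Rightarrow> nat \<Rightarrow> nat \<Rightarrow> 'a" where
  "weight_poly y 0 s = 1"
| "weight_poly y (Suc k) s =
    (if s = 2 * k + 2 then y * of_nat (2 * k + 1) * weight_poly y k (2 * k)
     else of_nat s * weight_poly y k (s - 1) + of_nat (2 * k + 1 - s) * weight_poly y k s)"

text \<open>If some \<open>x\<close> in \<open>A\<close> lies outside \<open>S\<close>, its pair is
  never inside \<open>S\<close>. In the induction step \<open>card S\<close> of its partners use up
  a point of \<open>S\<close>, and the other \<open>2 * k + 1 - card S\<close> leave
  \<open>S\<close> intact. If \<open>S = A\<close>, each of the \<open>2 * k + 1\<close> partners of
  any point gives a factor \<open>y\<close>.\<close>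

lemma weight_eq_weight_poly:
  assumes "finite A" "card A = 2 * k" "S \<subseteq> A"
  shows "weight y A S = weight_poly y k (card S)"
  using assms
proof (induction k arbitrary: A S)
  case 0
  then show ?case by (simp add: weight_def)
next
  case (Suc k)
  have fS: "finite S" using Suc.prems finite_subset by blast
  have cardA': "card (A - {x, z}) = 2 * k" if "x \<in> A" "z \<in> A - {x}" for x z
  proof -
    have "card {x, z} = 2" using that by auto
    then show ?thesis using that Suc.prems by (simp add: card_Diff_subset)
  qed
  show ?case
  proof (cases "S = A")
    case True
    obtain x where x: "x \<in> A" using Suc.prems by fastforce
    have "weight y A S = (\<Sum>z\<in>A - {x}. y * weight_poly y k (2 * k))"
      unfolding weight_by_partner[OF Suc.prems(1) x]
    proof (intro sum.cong refl)
      fix z assume z: "z \<in> A - {x}"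
      have "weight y (A - {x, z}) (A - {x, z}) = weight_poly y k (2 * k)"
        using Suc.IH[of "A - {x, z}" "A - {x, z}"] cardA'[OF x z] Suc.prems by simp
      then show "(if x \<in> S \<and> z \<in> S then y else 1) * weight y (A - {x, z}) (S - {x, z}) =
        y * weight_poly y k (2 * k)" using True x z by simp
    qed
    then show ?thesis using True x Suc.prems by (simp add: algebra_simps)
  next
    case False
    then obtain x where x: "x \<in> A" "x \<notin> S" using Suc.prems by auto
    have "card S < card A" using False Suc.prems psubset_card_mono by blast
    then have less: "card S \<le> 2 * k + 1" using Suc.prems by simp
    have "weight y A S =
      (\<Sum>z\<in>A - {x}. if z \<in> S then weight_poly y k (card S - 1) else weight_poly y k (card S))"
      unfolding weight_by_partner[OF Suc.prems(1) x(1)]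
    proof (intro sum.cong refl)
      fix z assume z: "z \<in> A - {x}"
      have "weight y (A - {x, z}) (S - {x, z}) = weight_poly y k (card (S - {x, z}))"
        using Suc.IH[of "A - {x, z}" "S - {x, z}"] cardA'[OF x(1) z] Suc.prems by auto
      moreover have "S - {x, z} = S - {z}" using x by auto
      ultimately show "(if x \<in> S \<and> z \<in> S then y else 1) * weight y (A - {x, z}) (S - {x, z}) =
        (if z \<in> S then weight_poly y k (card S - 1) else weight_poly y k (card S))"
        using x fS by simp
    qed
    also have "\<dots> = of_nat (card ((A - {x}) \<inter> S)) * weight_poly y k (card S - 1)
      + of_nat (card ((A - {x}) \<inter> - S)) * weight_poly y k (card S)"
      using Suc.prems by (simp add: sum.If_cases)
    also have "(A - {x}) \<inter> S = S" using x Suc.prems by auto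
    also have "(A - {x}) \<inter> - S = A - insert x S" by auto
    also have "card (A - insert x S) = 2 * k + 1 - card S"
      using x Suc.prems fS by (simp add: card_Diff_subset)
    finally show ?thesis using less by simp
  qed
qed

section \<open>Summation of the recurrence over the gap\<close>

text \<open>For \<open>s\<close> up to \<open>2 * k + 1\<close> only the second case of
  \<open>weight_poly\<close> occurs. Its first summand is shifted by one; the factor
  \<open>s\<close> kills the term at \<open>0\<close>, and \<open>2 * k + 1 - s\<close> kills the
  last term of the other sum. The weight \<open>f\<close> is left free because two different weights
  are needed.\<close>

lemma sum_weight_poly_Suc:
  "(\<Sum>s\<le>2 * k + 1. f s * weight_poly y (Suc k) s) =
   (\<Sum>s\<le>2 * k. (f (Suc s) * of_nat (Suc s) + f s * of_nat (2 * k + 1 - s)) * weight_poly y k s)"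
proof -
  have "(\<Sum>s\<le>2 * k + 1. f s * weight_poly y (Suc k) s) =
      (\<Sum>s\<le>Suc (2 * k). f s * of_nat s * weight_poly y k (s - 1)) +
      (\<Sum>s\<le>Suc (2 * k). f s * of_nat (2 * k + 1 - s) * weight_poly y k s)"
    by (simp add: sum.distrib[symmetric] algebra_simps del: sum.atMost_Suc)
  also have "(\<Sum>s\<le>Suc (2 * k). f s * of_nat s * weight_poly y k (s - 1)) =
      (\<Sum>s\<le>2 * k. f (Suc s) * of_nat (Suc s) * weight_poly y k s)"
    by (subst sum.atMost_Suc_shift) simp
  finally show ?thesis by (simp add: sum.distrib[symmetric] algebra_simps)
qed

text \<open>In the paper's notation \<open>odd_fact k\<close> is $(2k-1)!!$.\<close>
definition odd_fact :: "nat \<Rightarrow> nat" where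
  "odd_fact k = (\<Prod>i<k. 2 * i + 1)"

lemma odd_fact_0 [simp]: "odd_fact 0 = 1"
  by (simp add: odd_fact_def)

lemma odd_fact_Suc [simp]: "odd_fact (Suc k) = (2 * k + 1) * odd_fact k"
  by (simp add: odd_fact_def)

text \<open>This is the case \<open>S = A\<close>: all \<open>k\<close> pairs of each of the
  \<open>odd_fact k\<close> matchings lie inside the set.\<close>

lemma weight_poly_full: "weight_poly y k (2 * k) = of_nat (odd_fact k) * y ^ k"
  by (induction k) (simp_all add: algebra_simps)

text \<open>The weight \<open>s + 1\<close> is an eigenvector of the summed recurrence: \<open>(s +
  2) * (s + 1) + (s + 1) * (2 * k + 1 - s) = (2 * k + 3) * (s + 1)\<close>. The term
  \<open>s = 2 * k + 2\<close>, which that recurrence does not cover, supplies the new top power of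
  \<open>y\<close>.\<close>

lemma sum_Suc_weight_poly:
  "(\<Sum>s\<le>2 * k. of_nat (Suc s) * weight_poly y k s) = of_nat (odd_fact (Suc k)) * (\<Sum>p\<le>k. y ^ p)"
proof (induction k)
  case 0
  then show ?case by simp
next
  case (Suc k)
  have "(\<Sum>s\<le>2 * Suc k. of_nat (Suc s) * weight_poly y (Suc k) s) =
      (\<Sum>s\<le>2 * k + 1. of_nat (Suc s) * weight_poly y (Suc k) s)
      + of_nat (2 * k + 3) * weight_poly y (Suc k) (2 * Suc k)"
    by (simp add: algebra_simps eval_nat_numeral)
  also have "(\<Sum>s\<le>2 * k + 1. of_nat (Suc s) * weight_poly y (Suc k) s) =
     (\<Sum>s\<le>2 * k. of_nat (2 * k + 3) * (of_nat (Suc s) * weight_poly y k s))"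
    unfolding sum_weight_poly_Suc
  proof (intro sum.cong refl)
    fix s assume "s \<in> {..2 * k}"
    then have "Suc (Suc s) + (2 * k + 1 - s) = 2 * k + 3" by simp
    then have "Suc (Suc s) * Suc s + Suc s * (2 * k + 1 - s) = (2 * k + 3) * Suc s"
      by (metis distrib_right mult.commute)
    then have "of_nat (Suc (Suc s)) * of_nat (Suc s) + of_nat (Suc s) * of_nat (2 * k + 1 - s) =
      (of_nat (2 * k + 3) * of_nat (Suc s) :: 'a)"
      by (metis of_nat_add of_nat_mult)
    then show "(of_nat (Suc (Suc s)) * of_nat (Suc s) + of_nat (Suc s) * of_nat (2 * k + 1 - s)) *
        weight_poly y k s = of_nat (2 * k + 3) * (of_nat (Suc s) * weight_poly y k s)"
      by (simp only: mult.assoc)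
  qed
  also have "\<dots> = of_nat (2 * k + 3) * (of_nat (odd_fact (Suc k)) * (\<Sum>p\<le>k. y ^ p))"
    by (simp only: sum_distrib_left[symmetric] Suc.IH)
  also have "weight_poly y (Suc k) (2 * Suc k) = of_nat (odd_fact (Suc k)) * y ^ Suc k"
    by (rule weight_poly_full)
  finally have "(\<Sum>s\<le>2 * Suc k. of_nat (Suc s) * weight_poly y (Suc k) s) =
      of_nat (2 * k + 3) * (of_nat (odd_fact (Suc k)) * (\<Sum>p\<le>k. y ^ p)) +
      of_nat (2 * k + 3) * (of_nat (odd_fact (Suc k)) * y ^ Suc k)" .
  moreover have "odd_fact (Suc (Suc k)) = (2 * k + 3) * odd_fact (Suc k)"
    by (simp add: algebra_simps)
  ultimately show ?case
    by (simp only: of_nat_mult sum.atMost_Suc distrib_left mult.assoc)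
qed

text \<open>The index is shifted: \<open>config_poly y k\<close> is $\sum_p C_{k+1,p}\,y^p$.\<close>
definition config_poly :: "'a :: comm_semiring_1 \<Rightarrow> nat \<Rightarrow> 'a" where
  "config_poly y k = (\<Sum>s\<le>2 * k. of_nat (2 * k + 1 - s) * weight_poly y k s)"

text \<open>Under the summed recurrence the weight \<open>2 * k + 3 - s\<close> becomes
  \<open>2 * k + 4\<close> times the old weight \<open>2 * k + 1 - s\<close>, plus a remainder
  \<open>s + 1\<close> that \<open>sum_Suc_weight_poly\<close> evaluates. The term
  \<open>s = 2 * k + 2\<close> has weight \<open>1\<close> and completes the geometric sum.\<close>

lemma config_poly_Suc:
  "config_poly y (Suc k) =
    of_nat (2 * k + 4) * config_poly y k + of_nat (odd_fact (Suc k)) * (\<Sum>p\<le>Suc k. y ^ p)"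
proof -
  have "config_poly y (Suc k) =
      (\<Sum>s\<le>2 * k + 1. of_nat (2 * k + 3 - s) * weight_poly y (Suc k) s)
      + weight_poly y (Suc k) (2 * Suc k)"
    by (simp add: config_poly_def eval_nat_numeral)
  also have "(\<Sum>s\<le>2 * k + 1. of_nat (2 * k + 3 - s) * weight_poly y (Suc k) s) =
     (\<Sum>s\<le>2 * k. of_nat (2 * k + 4) * (of_nat (2 * k + 1 - s) * weight_poly y k s)
        + of_nat (Suc s) * weight_poly y k s)"
    unfolding sum_weight_poly_Suc
  proof (intro sum.cong refl)
    fix s assume "s \<in> {..2 * k}"
    \<comment> \<open>The substitution removes the truncated subtractions and leaves an identity of
      polynomials in \<open>s\<close> and \<open>r\<close>.\<close>
    then obtain r where "2 * k = s + r" by (auto simp: le_iff_add)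
    then have "(2 * k + 3 - Suc s) * Suc s + (2 * k + 3 - s) * (2 * k + 1 - s) =
        (2 * k + 4) * (2 * k + 1 - s) + Suc s"
      by (simp add: algebra_simps)
    then have "of_nat (2 * k + 3 - Suc s) * of_nat (Suc s) +
        of_nat (2 * k + 3 - s) * of_nat (2 * k + 1 - s) =
        (of_nat (2 * k + 4) * of_nat (2 * k + 1 - s) + of_nat (Suc s) :: 'a)"
      by (metis of_nat_add of_nat_mult)
    then show "(of_nat (2 * k + 3 - Suc s) * of_nat (Suc s) +
        of_nat (2 * k + 3 - s) * of_nat (2 * k + 1 - s)) * weight_poly y k s =
        of_nat (2 * k + 4) * (of_nat (2 * k + 1 - s) * weight_poly y k s)
        + of_nat (Suc s) * weight_poly y k s"
      by (simp only: mult.assoc distrib_right)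
  qed
  also have "\<dots> = of_nat (2 * k + 4) * config_poly y k
      + of_nat (odd_fact (Suc k)) * (\<Sum>p\<le>k. y ^ p)"
    by (simp only: config_poly_def sum.distrib sum_distrib_left[symmetric] sum_Suc_weight_poly)
  also have "weight_poly y (Suc k) (2 * Suc k) = of_nat (odd_fact (Suc k)) * y ^ Suc k"
    by (rule weight_poly_full)
  finally show ?thesis
    by (simp only: sum.atMost_Suc distrib_left add.assoc)
qed

section \<open>From configurations to the gap sums\<close>

lemma card_matching:
  assumes "finite A" "M \<in> matchings A"
  shows "2 * card M = card A"
proof -
  have "2 * card M = card (\<Union>M)"
    by (rule card_partition)
      (use assms finite_matching[OF assms] in
        \<open>auto simp: matchings_def partition_on_def disjoint_def\<close>)
  then show ?thesis using assms by (simp add: matchings_def partition_on_def)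
qed

lemma perfect_matchings_eq: "perfect_matchings n = matchings {1..2 * n}"
  by (simp add: perfect_matchings_def matchings_def)

text \<open>The witnesses in \<open>contained_by\<close> are ordered, so \<open>g < h\<close>
  identifies the outer two with \<open>g\<close> and \<open>h\<close>; the inner two are the minimum
  and maximum of \<open>e\<close>.\<close>

lemma contained_by_iff:
  assumes "g < h" "card e = 2"
  shows "contained_by e {g, h} \<longleftrightarrow> e \<subseteq> {g<..<h}"
proof
  assume "contained_by e {g, h}"
  then show "e \<subseteq> {g<..<h}"
    using assms by (auto simp: contained_by_def doubleton_eq_iff)
next
  assume sub: "e \<subseteq> {g<..<h}"
  obtain a b where "e = {a, b}" "a \<noteq> b" using assms by (meson card_2_iff)
  then have "e = {min a b, max a b}" "min a b < max a b" by (auto simp: min_def max_def)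
  with sub show "contained_by e {g, h}"
    unfolding contained_by_def
    by (intro exI[of _ g] exI[of _ h] exI[of _ "min a b"] exI[of _ "max a b"]) auto
qed

text \<open>A pair is coded by its smaller point \<open>g\<close> and the number \<open>s\<close> of
  points strictly between its ends. The range of \<open>g\<close> has \<open>m - s\<close> elements,
  which for \<open>m = 2 * k + 1\<close> is the weight in \<open>config_poly\<close>.\<close>

lemma two_subsets_eq:
  "{e. e \<subseteq> {1..m + 1 :: nat} \<and> card e = 2} =
    (\<lambda>(s, g). {g, g + s + 1}) ` (SIGMA s:{..<m}. {1..m - s})" (is "?L = ?R")
proof (intro set_eqI iffI)
  fix e assume e: "e \<in> ?L"
  then obtain a b where ab: "e = {a, b}" "a \<noteq> b" by (auto simp: card_2_iff)
  define g h where "g = min a b" and "h = max a b"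
  have gh: "e = {g, h}" "g < h" using ab by (auto simp: g_def h_def min_def max_def)
  define s where "s = h - g - 1"
  have h: "h = g + s + 1" using gh(2) by (simp add: s_def)
  have "1 \<le> g" "h \<le> m + 1" using e gh(1) by auto
  then have "(s, g) \<in> (SIGMA s:{..<m}. {1..m - s})" using h by auto
  then show "e \<in> ?R" unfolding gh(1) h by (rule image_eqI[rotated]) simp
next
  fix e assume "e \<in> ?R"
  then obtain s g where "s < m" "1 \<le> g" "g \<le> m - s" "e = {g, g + s + 1}" by auto
  then show "e \<in> ?L" by auto
qed

lemma inj_on_pair_of_gap:
  "inj_on (\<lambda>(s, g). {g, g + s + 1 :: nat}) X"
proof (rule inj_onI, clarify)
  fix s g s' g' :: nat
  assume "{g, g + s + 1} = {g', g' + s' + 1}"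
  then have "g = g' \<and> g + s + 1 = g' + s' + 1 \<or> g = g' + s' + 1 \<and> g + s + 1 = g'"
    by (simp only: doubleton_eq_iff)
  then show "s = s' \<and> g = g'" by linarith
qed

text \<open>Summing over the given pair first and deleting it leaves a weighted sum over matchings
  of \<open>2 * k\<close> points, which depends only on the gap of the pair.\<close>

lemma sum_configurations:
  "(\<Sum>(M, e)\<in>configurations (Suc k). y ^ card {e' \<in> M - {e}. contained_by e' e})
    = config_poly y k"
proof -
  define A where "A = {1..2 * Suc k}"
  let ?w = "\<lambda>M e. y ^ card {e' \<in> M - {e}. contained_by e' e}"
  let ?E = "{e. e \<subseteq> A \<and> card e = 2}"
  have A: "finite A" "A = {1..(2 * k + 1) + 1}" "card A = 2 * k + 2" by (auto simp: A_def)
  have conf: "configurations (Suc k) = {(M, e). M \<in> matchings A \<and> e \<in> M}"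
    by (simp only: configurations_def perfect_matchings_eq A_def)
  have "(\<Sum>(M, e)\<in>configurations (Suc k). ?w M e) =
      (\<Sum>(e, M)\<in>(SIGMA e:?E. {M \<in> matchings A. e \<in> M}). ?w M e)"
    by (rule sum.reindex_bij_witness[of _ prod.swap prod.swap])
      (use matchingsD[of _ A] in \<open>auto simp: conf\<close>)
  also have "\<dots> = (\<Sum>e\<in>?E. \<Sum>M | M \<in> matchings A \<and> e \<in> M. ?w M e)"
    by (rule sum.Sigma[symmetric]) (simp_all add: A(1) finite_matchings)
  also have "\<dots> = (\<Sum>e\<in>?E. \<Sum>M\<in>matchings (A - e). ?w (insert e M) e)"
    by (intro sum.cong refl sum_matchings_containing) auto
  also have "\<dots> = (\<Sum>(s, g)\<in>(SIGMA s:{..<2 * k + 1}. {1..2 * k + 1 - s}).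
      \<Sum>M\<in>matchings (A - {g, g + s + 1}). ?w (insert {g, g + s + 1} M) {g, g + s + 1})"
    unfolding A(2) two_subsets_eq
    by (subst sum.reindex[OF inj_on_pair_of_gap]) (simp add: case_prod_unfold)
  also have "\<dots> = (\<Sum>(s, g)\<in>(SIGMA s:{..<2 * k + 1}. {1..2 * k + 1 - s}). weight_poly y k s)"
  proof (intro sum.cong refl, clarify)
    fix s g assume sg: "s < 2 * k + 1" "g \<in> {1..2 * k + 1 - s}"
    define h where "h = g + s + 1"
    have gh: "g < h" "g \<in> A" "h \<in> A" using sg by (auto simp: h_def A_def)
    have "(\<Sum>M\<in>matchings (A - {g, h}). ?w (insert {g, h} M) {g, h}) =
        weight y (A - {g, h}) {g<..<h}"
      unfolding weight_def
    proof (intro sum.cong refl)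
      fix M assume M: "M \<in> matchings (A - {g, h})"
      then have "{g, h} \<notin> M" by (auto simp: matchings_def partition_on_def)
      moreover have "\<forall>e\<in>M. card e = 2" using M by (simp add: matchings_def)
      ultimately have "{e' \<in> insert {g, h} M - {{g, h}}. contained_by e' {g, h}} =
          {e \<in> M. e \<subseteq> {g<..<h}}"
        using contained_by_iff[OF gh(1)] by auto
      then show "?w (insert {g, h} M) {g, h} = y ^ card {e \<in> M. e \<subseteq> {g<..<h}}" by simp
    qed
    also have "\<dots> = weight_poly y k (card {g<..<h})"
    proof (rule weight_eq_weight_poly)
      show "card (A - {g, h}) = 2 * k" using gh A by (simp add: card_Diff_subset)
      show "{g<..<h} \<subseteq> A - {g, h}" using gh by (auto simp: A_def)
    qed (use A in simp)
    finally show "(\<Sum>M\<in>matchings (A - {g, g + s + 1}).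
        ?w (insert {g, g + s + 1} M) {g, g + s + 1}) = weight_poly y k s"
      by (simp add: h_def)
  qed
  \<comment> \<open>The summand no longer involves \<open>g\<close>, so the inner sum just
    multiplies by the number of positions with gap \<open>s\<close>.\<close>
  also have "\<dots> = (\<Sum>s<2 * k + 1. \<Sum>g\<in>{1..2 * k + 1 - s}. weight_poly y k s)"
    by (rule sum.Sigma[symmetric]) auto
  also have "\<dots> = config_poly y k"
    by (simp add: config_poly_def lessThan_Suc_atMost)
  finally show ?thesis .
qed

text \<open>Configurations are grouped by their number of contained pairs. There are only
  \<open>k\<close> other pairs, so the values \<open>0\<close> to \<open>k\<close> exhaust
  them.\<close>

lemma sum_C_count: "(\<Sum>p = 0..k. of_nat (C_count (Suc k) p) * y ^ p) = config_poly y k"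
proof -
  let ?f = "\<lambda>(M, e). card {e' \<in> M - {e}. contained_by e' e}"
  have fin: "finite (configurations (Suc k))"
  proof (rule finite_subset)
    show "configurations (Suc k) \<subseteq> matchings {1..2 * Suc k} \<times> Pow {1..2 * Suc k}"
      by (auto simp: configurations_def perfect_matchings_eq matchings_def partition_on_def)
  qed (simp add: finite_matchings)
  have "?f c \<in> {0..k}" if "c \<in> configurations (Suc k)" for c
  proof -
    obtain M e where "c = (M, e)" by (cases c)
    with that have c: "c = (M, e)" "M \<in> matchings {1..2 * Suc k}" "e \<in> M"
      by (simp_all add: configurations_def perfect_matchings_eq)
    have "card {e' \<in> M - {e}. contained_by e' e} \<le> card (M - {e})"
      using finite_matching c by (intro card_mono) auto
    also have "\<dots> = k" using c card_matching[OF _ c(2)] by simp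
    finally show ?thesis using c by simp
  qed
  then have "?f ` configurations (Suc k) \<subseteq> {0..k}" by blast
  then have "(\<Sum>c\<in>configurations (Suc k). y ^ ?f c) =
      (\<Sum>p = 0..k. \<Sum>c | c \<in> configurations (Suc k) \<and> ?f c = p. y ^ ?f c)"
    using fin by (intro sum.group[symmetric]) auto
  also have "\<dots> = (\<Sum>p = 0..k. of_nat (C_count (Suc k) p) * y ^ p)"
  proof (intro sum.cong refl)
    fix p
    have "{c. c \<in> configurations (Suc k) \<and> ?f c = p} =
        {(M, e) \<in> configurations (Suc k). card {e' \<in> M - {e}. contained_by e' e} = p}"
      by auto
    then have "card {c. c \<in> configurations (Suc k) \<and> ?f c = p} = C_count (Suc k) p"
      by (simp only: C_count_def)
    moreover have "(\<Sum>c | c \<in> configurations (Suc k) \<and> ?f c = p. y ^ ?f c) =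
        (\<Sum>c | c \<in> configurations (Suc k) \<and> ?f c = p. y ^ p)"
      by (rule sum.cong) auto
    ultimately show "(\<Sum>c | c \<in> configurations (Suc k) \<and> ?f c = p. y ^ ?f c) =
        of_nat (C_count (Suc k) p) * y ^ p"
      by (simp only: sum_constant)
  qed
  finally show ?thesis
    using sum_configurations[where y = y and k = k] by (simp add: case_prod_unfold)
qed

section \<open>Binomial series of the square roots\<close>

text \<open>Consecutive coefficients of the binomial series have ratio
  \<open>(1 / 2 - (k + 1)) / (k + 2)\<close>; multiplied by \<open>-2\<close>, the numerator becomes
  \<open>2 * k + 1\<close>, the next factor of \<open>odd_fact\<close>.\<close>

lemma gchoose_half_Suc:
  "(- 2) ^ Suc k * ((1 / 2 :: 'a :: field_char_0) gchoose Suc k) =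
    - (of_nat (odd_fact k) / fact (Suc k))"
proof (induction k)
  case 0
  then show ?case by simp
next
  case (Suc k)
  have step: "of_nat (Suc (Suc k)) * ((1 / 2 :: 'a) gchoose Suc (Suc k)) =
      (1 / 2 - of_nat (Suc k)) * ((1 / 2) gchoose Suc k)"
    using gbinomial_mult_1[of "1 / 2 :: 'a" "Suc k"]
    by (metis add_diff_cancel_left' left_diff_distrib)
  have "of_nat (Suc (Suc k)) * ((- 2) ^ Suc (Suc k) * ((1 / 2 :: 'a) gchoose Suc (Suc k))) =
      (- 2) ^ Suc (Suc k) * (of_nat (Suc (Suc k)) * ((1 / 2) gchoose Suc (Suc k)))"
    by (rule mult.left_commute)
  also have "\<dots> = (- 2 * (1 / 2 - of_nat (Suc k))) * ((- 2) ^ Suc k * ((1 / 2) gchoose Suc k))"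
    unfolding step by (simp only: power_Suc[of _ "Suc k"] mult_ac)
  also have "\<dots> = - (of_nat (odd_fact (Suc k)) / fact (Suc k))"
    unfolding Suc.IH by (simp add: algebra_simps)
  finally have *: "of_nat (Suc (Suc k)) * ((- 2) ^ Suc (Suc k) * ((1 / 2 :: 'a) gchoose Suc (Suc k)))
    = - (of_nat (odd_fact (Suc k)) / fact (Suc k))" .
  have "of_nat (Suc (Suc k)) \<noteq> (0 :: 'a)" by (rule of_nat_neq_0)
  then have "(- 2) ^ Suc (Suc k) * ((1 / 2 :: 'a) gchoose Suc (Suc k))
      = - (of_nat (odd_fact (Suc k)) / fact (Suc k)) / of_nat (Suc (Suc k))"
    by (subst *[symmetric]) (rule nonzero_mult_div_cancel_left[symmetric])
  then show ?case by (simp only: fact_Suc[of "Suc k"] divide_divide_eq_left mult_ac minus_divide_left)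
qed

text \<open>By uniqueness of the root with constant term \<open>1\<close>, it suffices to square the
  composed series; the square of the binomial series is \<open>1 + fps_X\<close>.\<close>

lemma sqrt_fps_linear:
  "sqrt_fps (1 - 2 * fps_const c * fps_X) =
    fps_compose (fps_binomial (1 / 2)) (fps_const (- 2 * c) * fps_X)"
proof -
  let ?g = "fps_compose (fps_binomial (1 / 2)) (fps_const (- 2 * c) * fps_X)"
  have "?g ^ 2 = fps_compose (fps_binomial (1 / 2) ^ 2) (fps_const (- 2 * c) * fps_X)"
    by (rule fps_compose_power) simp
  also have "fps_binomial (1 / 2) ^ 2 = (1 + fps_X :: 'a fps)"
    by (simp add: fps_binomial_power fps_binomial_1)
  also have "fps_compose (1 + fps_X) (fps_const (- 2 * c) * fps_X) =
      1 - 2 * fps_const c * fps_X"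
    by (simp add: fps_compose_add_distrib numeral_fps_const flip: fps_const_neg)
  finally have "?g ^ 2 = 1 - 2 * fps_const c * fps_X" .
  then show ?thesis
    using sqrt_fps_unique[of "1 - 2 * fps_const c * fps_X" ?g] by simp
qed

lemma sqrt_fps_linear_nth_0: "sqrt_fps (1 - 2 * fps_const c * fps_X) $ 0 = 1"
  by (simp add: sqrt_fps_linear)

lemma sqrt_fps_linear_nth_Suc:
  "sqrt_fps (1 - 2 * fps_const c * fps_X) $ Suc k =
    - (of_nat (odd_fact k) / fact (Suc k)) * c ^ Suc k"
proof -
  have "sqrt_fps (1 - 2 * fps_const c * fps_X) $ Suc k =
      ((- 2) ^ Suc k * ((1 / 2) gchoose Suc k)) * c ^ Suc k"
    unfolding sqrt_fps_linear fps_nth_compose_linear fps_binomial_nth power_mult_distrib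
    by (simp only: mult_ac)
  then show ?thesis by (simp only: gchoose_half_Suc)
qed

section \<open>Coefficients of the generating function\<close>

lemma C_gf_nth_0: "C_gf $ 0 = 0"
  by (simp add: C_gf_def)

lemma C_gf_nth_Suc: "C_gf $ Suc k = config_poly Y k / fact (Suc k)"
  unfolding C_gf_def using sum_C_count[of k Y] by simp

text \<open>Multiplication by \<open>1 - 2 * fps_X\<close> cancels the homogeneous part of
  \<open>config_poly_Suc\<close>, leaving only its inhomogeneous term.\<close>

lemma C_gf_times_linear_nth_Suc:
  "(C_gf * (1 - 2 * fps_X)) $ Suc k = of_nat (odd_fact k) / fact (Suc k) * (\<Sum>p\<le>k. Y ^ p)"
proof -
  have "C_gf * (1 - 2 * fps_X) = C_gf - fps_const 2 * (fps_X * C_gf)"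
    unfolding numeral_fps_const by (simp add: algebra_simps)
  then have "(C_gf * (1 - 2 * fps_X)) $ Suc k = C_gf $ Suc k - 2 * C_gf $ k"
    by simp
  also have "\<dots> = of_nat (odd_fact k) / fact (Suc k) * (\<Sum>p\<le>k. Y ^ p)"
  proof (cases k)
    \<comment> \<open>The constant coefficient of \<open>C_gf\<close> is \<open>0\<close> by
      convention and not a value of \<open>config_poly\<close>, so the recurrence does not apply
      here.\<close>
    case 0
    then show ?thesis by (simp add: C_gf_nth_0 C_gf_nth_Suc config_poly_def)
  next
    case (Suc j)
    \<comment> \<open>The factor \<open>j + 2\<close> cancels against the last factor of
      \<open>fact (Suc (Suc j))\<close>, leaving exactly twice the preceding coefficient.\<close>
    have "of_nat (2 * j + 4) = (2 * of_nat (Suc (Suc j)) :: ratfun)" by simp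
    moreover have "of_nat (Suc (Suc j)) \<noteq> (0 :: ratfun)" by (rule of_nat_neq_0)
    ultimately show ?thesis
      unfolding Suc C_gf_nth_Suc config_poly_Suc fact_Suc[of "Suc j"]
      by (simp add: field_simps del: of_nat_Suc fact_Suc odd_fact_Suc sum.atMost_Suc)
  qed
  finally show ?thesis .
qed

theorem theorem13:
  shows "C_gf =
    (sqrt_fps (1 - 2 * fps_const Y * fps_X) - sqrt_fps (1 - 2 * fps_X)) /
    ((1 - 2 * fps_X) * (1 - fps_const Y))"
proof -
  let ?N = "sqrt_fps (1 - 2 * fps_const Y * fps_X) - sqrt_fps (1 - 2 * fps_X)"
  let ?D = "(1 - 2 * fps_X) * (1 - fps_const Y)"
  \<comment> \<open>The constant term of the denominator is \<open>1 - Y\<close>.\<close>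
  have "Y \<noteq> 1" by (simp add: Y_def One_fract_def eq_fract one_pCons)
  then have "?D $ 0 \<noteq> 0" by simp
  then have "?D \<noteq> 0" by (metis fps_zero_nth)
  \<comment> \<open>Written with \<open>c = 1\<close>, the second root falls under the same
    coefficient formula as the first.\<close>
  have one: "sqrt_fps (1 - 2 * fps_X) = sqrt_fps (1 - 2 * fps_const (1 :: ratfun) * fps_X)"
    by simp
  have "C_gf * ?D = ?N"
  proof (rule fps_ext)
    fix n
    have "C_gf * ?D = fps_const (1 - Y) * (C_gf * (1 - 2 * fps_X))"
      by (simp add: algebra_simps flip: fps_const_sub)
    then have "(C_gf * ?D) $ n = (1 - Y) * (C_gf * (1 - 2 * fps_X)) $ n"
      by (simp only: fps_mult_left_const_nth)
    also have "\<dots> = ?N $ n"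
    proof (cases n)
      case 0
      have "sqrt_fps (1 - 2 * fps_X :: ratfun fps) $ 0 = 1"
        by (simp only: one sqrt_fps_linear_nth_0)
      with 0 show ?thesis by (simp add: sqrt_fps_linear_nth_0 C_gf_nth_0)
    next
      case (Suc k)
      have "(1 - Y) * (C_gf * (1 - 2 * fps_X)) $ n =
          of_nat (odd_fact k) / fact (Suc k) * ((1 - Y) * (\<Sum>p\<le>k. Y ^ p))"
        unfolding Suc C_gf_times_linear_nth_Suc by (simp only: mult_ac)
      \<comment> \<open>The telescoping geometric sum yields the difference of the two square root
        coefficients.\<close>
      also have "(1 - Y) * (\<Sum>p\<le>k. Y ^ p) = 1 - Y ^ Suc k"
        by (rule sum_gp_basic)
      finally show ?thesis
        by (simp only: Suc one fps_sub_nth sqrt_fps_linear_nth_Suc power_one right_diff_distrib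
            mult_1_right mult_minus_left diff_minus_eq_add uminus_add_conv_diff)
    qed
    finally show "(C_gf * ?D) $ n = ?N $ n" .
  qed
  then show ?thesis
    using \<open>?D \<noteq> 0\<close> by (metis nonzero_mult_div_cancel_right)
qed

end
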